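(* Let $p \in [1,+\infty)$ and $\alpha \in (1/2,1)$. There exists a sequence $(\mathbf{X}_n)$ of elements $\mathbf{X}_n \in M_n$ such that \begin{itemize} \item $\|\mathbf{X}_n\|_\infty \le 2$ for every $n$, \item $s(\mathbf{X}_n) \simeq \sqrt{n}$, \item $\|V^2(\mathbf{X}_n) - 1\|_p^{p/(2p+1)} = O\left( n^{(\alpha-1)/2} \right)$ as $n\to+\infty$, \item $\limsup_{n\to+\infty} n^{(1-\alpha)/2} D(\mathbf{X}_n) > 0$. \end{itemize}
   Context: $M_n$ denotes the set of all square-integrable martingale difference sequences of length $n$, i.e. sequences $\mathbf{X} = (X_1,\ldots,X_n)$ of square-integrable real random variables (on some probability space) such that $\mathbb{E}[X_i \mid \mathcal{F}_{i-1}] = 0$ for every $1\le i\le n$, where $\mathcal{F}_i$ is the $\sigma$-algebra generated by $(X_1,\ldots,X_i)$ ($\mathcal{F}_0$ trivial). For $\mathbf{X}\in M_n$ define $$s^2(\mathbf{X}) = \sum_{i=1}^n \mathbb{E}[X_i^2], \qquad V^2(\mathbf{X}) = s^{-2}(\mathbf{X}) \sum_{i=1}^n \mathbb{E}[X_i^2 \mid \mathcal{F}_{i-1}], \qquad S(\mathbf{X}) = \sum_{i=1}^n X_i,$$ with $s(\mathbf{X})\ge 0$ the square root of $s^2(\mathbf{X})$. Let $\Phi(t) = (2\pi)^{-1/2}\int_{-\infty}^t e^{-x^2/2}\,dx$ and $$D(\mathbf{X}) = \sup_{t\in\mathbb{R}} \left| \mathbb{P}[S(\mathbf{X})/s(\mathbf{X})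 \le t] - \Phi(t) \right|.$$ ($V^2$ and $D$ are considered when $s(\mathbf{X})>0$.) For a random variable $Y$, $\|Y\|_p$ is its $L^p$ norm, and for a sequence, $\|\mathbf{X}\|_p = \max_{1\le i\le n} \|X_i\|_p$ for $p\in[1,+\infty]$. We write $a_n \simeq b_n$ if there exists $C>0$ such that $a_n/C \le b_n \le C a_n$ for all sufficiently large $n$. *)

theory Defs
  imports "HOL-Probability.Probability" "HOL-Library.Landau_Symbols"
begin

text \<open>
  A sequence of length n is represented by the values at the indices 1, ..., n of a function
  \<^typ>\<open>nat \<Rightarrow> 'a \<Rightarrow> real\<close>; its values at other indices are irrelevant. For i = 0 the
  following is the trivial sigma-algebra.
\<close>

definition gen_filt :: "'a measure \<Rightarrow> (nat \<Rightarrow> 'a \<Rightarrow> real) \<Rightarrow> nat \<Rightarrow> 'a measure" where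
  "gen_filt M X i =
     sigma (space M) {X j -` A \<inter> space M | j A. j \<in> {1..i} \<and> A \<in> sets borel}"

definition mart_diff_seq :: "'a measure \<Rightarrow> nat \<Rightarrow> (nat \<Rightarrow> 'a \<Rightarrow> real) \<Rightarrow> bool" where
  "mart_diff_seq M n X \<longleftrightarrow> prob_space M \<and>
     (\<forall>i\<in>{1..n}. X i \<in> borel_measurable M \<and> integrable M (\<lambda>\<omega>. (X i \<omega>)\<^sup>2) \<and>
        (AE \<omega> in M. real_cond_exp M (gen_filt M X (i - 1)) (X i) \<omega> = 0))"

definition mds_s2 :: "'a measure \<Rightarrow> nat \<Rightarrow> (nat \<Rightarrow> 'a \<Rightarrow> real) \<Rightarrow> real" where
  "mds_s2 M n X = (\<Sum>i=1..n. integral\<^sup>L M (\<lambda>\<omega>. (X i \<omega>)\<^sup>2))"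

definition mds_s :: "'a measure \<Rightarrow> nat \<Rightarrow> (nat \<Rightarrow> 'a \<Rightarrow> real) \<Rightarrow> real" where
  "mds_s M n X = sqrt (mds_s2 M n X)"

definition mds_V2 :: "'a measure \<Rightarrow> nat \<Rightarrow> (nat \<Rightarrow> 'a \<Rightarrow> real) \<Rightarrow> 'a \<Rightarrow> real" where
  "mds_V2 M n X \<omega> =
     (\<Sum>i=1..n. real_cond_exp M (gen_filt M X (i - 1)) (\<lambda>\<omega>'. (X i \<omega>')\<^sup>2) \<omega>) / mds_s2 M n X"

definition mds_S :: "nat \<Rightarrow> (nat \<Rightarrow> 'a \<Rightarrow> real) \<Rightarrow> 'a \<Rightarrow> real" where
  "mds_S n X \<omega> = (\<Sum>i=1..n. X i \<omega>)"

definition Phi :: "real \<Rightarrow> real" where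
  "Phi t = 1 / sqrt (2 * pi) * (LINT x:{..t}|lborel. exp (- x\<^sup>2 / 2))"

definition mds_D :: "'a measure \<Rightarrow> nat \<Rightarrow> (nat \<Rightarrow> 'a \<Rightarrow> real) \<Rightarrow> real" where
  "mds_D M n X = (SUP t. \<bar>measure M {\<omega> \<in> space M. mds_S n X \<omega> / mds_s M n X \<le> t} - Phi t\<bar>)"

text \<open>
  The norm takes values in \<^typ>\<open>ennreal\<close>, so that it is infinite, rather than 0, on functions
  whose p-th power is not integrable. The exponent p ranges over [1, \<infinity>].
\<close>

definition Lp_norm :: "'a measure \<Rightarrow> ennreal \<Rightarrow> ('a \<Rightarrow> real) \<Rightarrow> ennreal" where
  "Lp_norm M p Y =
     (if p = \<infinity> then esssup M (\<lambda>\<omega>. ennreal \<bar>Y \<omega>\<bar>)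
      else let I = (\<integral>\<^sup>+\<omega>. ennreal (\<bar>Y \<omega>\<bar> powr enn2real p) \<partial>M)
           in if I = \<infinity> then \<infinity> else ennreal (enn2real I powr (1 / enn2real p)))"

definition seq_norm :: "'a measure \<Rightarrow> ennreal \<Rightarrow> nat \<Rightarrow> (nat \<Rightarrow> 'a \<Rightarrow> real) \<Rightarrow> ennreal" where
  "seq_norm M p n X = Max ((\<lambda>i. Lp_norm M p (X i)) ` {1..n})"

definition same_order :: "(nat \<Rightarrow> real) \<Rightarrow> (nat \<Rightarrow> real) \<Rightarrow> bool" where
  "same_order a b \<longleftrightarrow>
     (\<exists>C>0. eventually (\<lambda>n. a n / C \<le> b n \<and> b n \<le> C * a n) sequentially)"

lemma Phi_eq_cdf: "Phi t = cdf std_normal_distribution t"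
proof -
  interpret N: prob_space std_normal_distribution
    by (rule prob_space_normal_density) simp
  have "cdf std_normal_distribution t
      = integral\<^sup>L std_normal_distribution (indicator {..t} :: real \<Rightarrow> real)"
    unfolding cdf_def by simp
  also have "\<dots> = (LINT x|lborel. std_normal_density x * indicator {..t} x)"
    by (subst integral_density) auto
  also have "\<dots> = Phi t"
    by (simp add: Phi_def std_normal_density_def set_lebesgue_integral_def mult.commute
        mult.left_commute)
  finally show ?thesis ..
qed

lemma bdd_above_mds_D:
  assumes "prob_space M"
  shows "bdd_above (range (\<lambda>t. \<bar>measure M {\<omega> \<in> space M. mds_S n X \<omega> / mds_s M n X \<le> t} - Phi t\<bar>))"
proof (rule bdd_aboveI2[where M = 1])
  fix t
  interpret M: prob_space M by fact
  interpret N: prob_space std_normal_distribution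
    by (rule prob_space_normal_density) simp
  have "0 \<le> Phi t" "Phi t \<le> 1"
    unfolding Phi_eq_cdf cdf_def by simp_all
  then show "\<bar>measure M {\<omega> \<in> space M. mds_S n X \<omega> / mds_s M n X \<le> t} - Phi t\<bar> \<le> 1"
    using M.prob_le_1[of "{\<omega> \<in> space M. mds_S n X \<omega> / mds_s M n X \<le> t}"]
      measure_nonneg[of M "{\<omega> \<in> space M. mds_S n X \<omega> / mds_s M n X \<le> t}"] by linarith
qed

lemma subalgebra_gen_filt:
  assumes "mart_diff_seq M n X" and "i \<le> n"
  shows "subalgebra M (gen_filt M X i)"
proof -
  have "{X j -` A \<inter> space M | j A. j \<in> {1..i} \<and> A \<in> sets borel} \<subseteq> sets M"
    using assms by (fastforce simp: mart_diff_seq_def intro: measurable_sets)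
  then show ?thesis
    unfolding subalgebra_def gen_filt_def
    by (auto simp: space_measure_of_conv intro!: sets.sigma_sets_subset
        dest: sets.sets_into_space[THEN subsetD] subsetD
        simp: sets_measure_of[OF order.trans[OF _ sets.space_closed]])
qed

end

theory Submission
  imports Defs "HOL-Real_Asymp.Real_Asymp"
begin

text \<open>
  The sequence is a simple random walk that is stopped, with small probability, shortly before time
  \<open>n\<close>. Write \<open>\<delta> = n powr ((\<alpha> - 1) / 2)\<close>. Take \<open>n\<close> independent fair signs and let \<open>k\<close>, of order
  \<open>n powr \<alpha> = \<delta>\<^sup>2 * n\<close>, be the length of a final block of steps. If the walk at time \<open>m = n - k\<close> lies in
  the window \<open>(0, 2 * h]\<close>, where \<open>h\<close> is of order \<open>sqrt k\<close>, then all later differences are set to 0;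
  otherwise nothing is changed. As the local probabilities of the walk at time \<open>m\<close> are of order
  \<open>1 / sqrt n\<close> near 0, the window is met with a probability \<open>\<mu>\<close> of order \<open>h / sqrt n\<close>, that is, of
  order \<open>\<delta>\<close>.

  The effect on the conditional variances is small. The sum of the squared differences is
  \<open>n - k * indicator\<close>, with mean \<open>s\<^sup>2 = n - k * \<mu>\<close>, so that \<open>V\<^sup>2 - 1\<close> is of order \<open>\<delta>\<^sup>2\<close> in the window and
  of order \<open>\<delta>\<^sup>2 * \<mu>\<close> outside. The expectation of its \<open>p\<close>-th power is of order \<open>\<delta> powr (2 * p + 1)\<close>
  (\<open>Lp_norm_V2_le\<close>, \<open>norm_V2_le\<close>).

  The effect on the distribution function at 0 is of order \<open>\<delta>\<close>. Stopping in the window removes from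
  the event that the walk ends below 0 exactly those paths that visit the window at time \<open>m\<close> and end
  below 0. Since \<open>h\<close> is a small multiple of \<open>sqrt k\<close>, a fixed proportion of the paths that visit the
  window do so. For odd \<open>n\<close> the unmodified walk ends below 0 with probability \<open>1 / 2 = \<Phi>(0)\<close> by
  symmetry, so the whole effect is visible in the distance to the normal law
  (\<open>mds_D_stopped_signs_lower\<close>). Odd \<open>n\<close> suffice for the upper limit.

  All estimates on the walk come from elementary bounds on binomial coefficients near the centre of
  a row: \<open>window_prob_upper\<close>, \<open>window_prob_lower\<close> and \<open>walk_prob_lower_tail\<close>.
\<close>

section \<open>Binomial coefficients near the centre of a row\<close>

lemma central_binomial_Suc:
  "real (2 * Suc k choose Suc k) * (real k + 1) = 2 * (2 * real k + 1) * real (2 * k choose k)"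
proof -
  \<comment> \<open>Going through row \<open>2 * k + 1\<close>, the two absorption identities cancel its entry \<open>b\<close>.\<close>
  define a b c where "a = (2 * Suc k choose Suc k)" "b = (2 * k + 1 choose k)" "c = (2 * k choose k)"
  have "(2 * k + 2) * b = a * Suc k"
    using Suc_times_binomial_eq[of "2 * k + 1" k] by (simp add: a_b_c_def)
  moreover have "(2 * k + 1) * c = b * Suc k"
    using Suc_times_binomial_eq[of "2 * k" k] binomial_symmetric[of k "2 * k + 1"]
    by (simp add: a_b_c_def)
  ultimately have "a * (k + 1) = 2 * (2 * k + 1) * c"
    by (simp add: algebra_simps)
  then have "real (a * (k + 1)) = real (2 * (2 * k + 1) * c)"
    by (simp only:)
  then show ?thesis
    by (simp add: a_b_c_def(1,3)[symmetric] add_ac del: mult_Suc_right)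
qed

text \<open>
  The ratio of consecutive central binomial coefficients is \<open>4 - 2 / (k + 1)\<close>, so that they grow like
  \<open>4 ^ k / sqrt k\<close>. The squared form of the bounds keeps the induction steps polynomial: they amount to
  \<open>(2 * k + 1) * (2 * k + 3) \<le> 4 * (k + 1)\<^sup>2\<close> and \<open>4 * k * (k + 1) \<le> (2 * k + 1)\<^sup>2\<close>.
\<close>

lemma central_binomial_square_upper:
  "(real (2 * k choose k))\<^sup>2 * (2 * real k + 1) \<le> 16 ^ k"
proof (induction k)
  case (Suc k)
  let ?c = "real (2 * k choose k)" and ?d = "real (2 * Suc k choose Suc k)"
  have "?d\<^sup>2 * (2 * real (Suc k) + 1) * (real k + 1)\<^sup>2
      = (?d * (real k + 1))\<^sup>2 * (2 * real k + 3)"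
    by (simp add: power_mult_distrib)
  also have "\<dots> = 4 * (?c\<^sup>2 * (2 * real k + 1)) * ((2 * real k + 1) * (2 * real k + 3))"
    unfolding central_binomial_Suc by algebra
  also have "\<dots> \<le> 4 * 16 ^ k * (4 * (real k + 1)\<^sup>2)"
  proof (rule mult_mono)
    show "(2 * real k + 1) * (2 * real k + 3) \<le> 4 * (real k + 1)\<^sup>2"
      by (simp add: power2_eq_square algebra_simps)
  qed (use Suc.IH in auto)
  also have "\<dots> = 16 ^ Suc k * (real k + 1)\<^sup>2"
    by simp
  finally show ?case
    by (rule mult_right_le_imp_le) simp
qed simp

lemma central_binomial_square_lower:
  assumes "1 \<le> k"
  shows "16 ^ k \<le> (real (2 * k choose k))\<^sup>2 * (4 * real k)"
  using assms
proof (induction k rule: dec_induct)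
  case base
  show ?case by simp
next
  case (step k)
  let ?c = "real (2 * k choose k)" and ?d = "real (2 * Suc k choose Suc k)"
  have "16 ^ Suc k * (real k * (real k + 1)) = 16 ^ k * (16 * (real k * (real k + 1)))"
    by simp
  also have "\<dots> \<le> (?c\<^sup>2 * (4 * real k)) * (4 * (2 * real k + 1)\<^sup>2)"
  proof (rule mult_mono)
    show "16 * (real k * (real k + 1)) \<le> 4 * (2 * real k + 1)\<^sup>2"
      by (simp add: power2_eq_square algebra_simps)
  qed (use step.IH in auto)
  also have "\<dots> = (?d * (real k + 1))\<^sup>2 * (4 * real k)"
    unfolding central_binomial_Suc by algebra
  also have "\<dots> = ?d\<^sup>2 * (4 * real (Suc k)) * (real k * (real k + 1))"
    by (simp only: of_nat_Suc) algebra
  finally show ?case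
    by (rule mult_right_le_imp_le) (use step.hyps in simp)
qed

lemma power_16_eq: "(16::real) ^ k = (4 ^ k)\<^sup>2"
  by (simp add: power2_eq_square flip: power_mult_distrib)

lemma central_binomial_upper: "real (2 * k choose k) * sqrt (2 * real k + 1) \<le> 4 ^ k"
  using central_binomial_square_upper[of k, unfolded power_16_eq]
  by - (rule power2_le_imp_le, simp_all add: power_mult_distrib)

lemma central_binomial_lower: "4 ^ k \<le> real (2 * k choose k) * (2 * sqrt (real k))" if "1 \<le> k"
  using central_binomial_square_lower[OF that, unfolded power_16_eq]
  by - (rule power2_le_imp_le, simp_all add: power_mult_distrib)

text \<open>
  The law of \<open>n\<close> fair signs has no atom heavier than \<open>1 / sqrt (n + 1)\<close>. For odd \<open>n\<close> the bound comes
  from row \<open>n + 1\<close>: the two central coefficients of row \<open>n\<close> are equal and add up to the central one of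
  the next row.
\<close>

lemma binomial_le_div_sqrt: "real (n choose a) \<le> 2 ^ n / sqrt (real n + 1)"
proof -
  have "real (n choose (n div 2)) * sqrt (real n + 1) \<le> 2 ^ n"
  proof (cases "even n")
    case True
    then obtain k where "n = 2 * k" by (elim evenE)
    then show ?thesis
      using central_binomial_upper[of k] by (simp add: power_mult add.commute)
  next
    case False
    then obtain k where n: "n = 2 * k + 1" by (elim oddE)
    have "2 * (n choose k) = 2 * Suc k choose Suc k"
      using binomial_symmetric[of k n] n by simp
    then have "2 * real (n choose k) = real (2 * Suc k choose Suc k)"
      by (metis of_nat_mult of_nat_numeral)
    moreover have "sqrt (real n + 1) \<le> sqrt (2 * real (Suc k) + 1)"
      using n by simp
    ultimately have "2 * real (n choose k) * sqrt (real n + 1)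
        \<le> real (2 * Suc k choose Suc k) * sqrt (2 * real (Suc k) + 1)"
      by (intro mult_mono) auto
    also have "\<dots> \<le> 2 * 2 ^ n"
      using central_binomial_upper[of "Suc k"] n by (simp add: power_mult)
    finally show ?thesis using n by simp
  qed
  moreover have "real (n choose a) \<le> real (n choose (n div 2))"
    using binomial_maximum by simp
  ultimately show ?thesis
    by (simp add: pos_le_divide_eq mult_right_mono order.trans[of _ "real (n choose (n div 2)) * sqrt (real n + 1)"])
qed

text \<open>
  Step \<open>j\<close> away from the centre multiplies the coefficient by \<open>1 - (2 * j + 1) / (q + j + 1)\<close>, and
  the odd numbers \<open>2 * j + 1\<close> add up to a square. Hence the coefficients stay comparable to the central
  one over a distance of order \<open>sqrt q\<close>.
\<close>

lemma binomial_near_centre: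
  "(1 - (real j)\<^sup>2 / (real q + 1)) * real (2 * q choose q) \<le> real (2 * q choose (q + j))"
proof (induction j)
  case (Suc j)
  let ?x = "(real j)\<^sup>2 / (real q + 1)" and ?y = "(2 * real j + 1) / (real q + 1)"
  let ?b = "\<lambda>j. real (2 * q choose (q + j))"
  have xy: "1 - (real (Suc j))\<^sup>2 / (real q + 1) = 1 - ?x - ?y"
  proof -
    have "(real (Suc j))\<^sup>2 = (real j)\<^sup>2 + (2 * real j + 1)"
      by (simp add: power2_eq_square algebra_simps)
    then show ?thesis
      by (simp only: add_divide_distrib diff_diff_eq)
  qed
  show ?case
  proof (cases "?x + ?y \<le> 1")
    case False
    then have "(1 - (real (Suc j))\<^sup>2 / (real q + 1)) * ?b 0 \<le> 0"
      unfolding xy by (intro mult_nonpos_nonneg) auto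
    also have "\<dots> \<le> ?b (Suc j)"
      by simp
    finally show ?thesis by simp
  next
    case True
    have "0 \<le> ?x" "0 \<le> ?y" by simp_all
    have "?y \<le> 1"
      using True \<open>0 \<le> ?x\<close> by linarith
    have "2 * real j + 1 \<le> real q + 1"
      using \<open>?y \<le> 1\<close> by (simp add: divide_le_eq)
    then have jq: "j \<le> q" by simp
    have "(2 * q choose (q + Suc j)) * Suc (q + j) = (2 * q choose (q + j)) * (q - j)"
    proof -
      have "Suc (q + j) * (2 * q choose Suc (q + j)) = (2 * q - (q + j)) * (2 * q choose (q + j))"
        by (simp only: binomial_absorption binomial_absorb_comp)
      moreover have "2 * q - (q + j) = q - j" by simp
      ultimately show ?thesis
        by (simp only: mult.commute add_Suc_right)
    qed
    then have "real ((2 * q choose (q + Suc j)) * Suc (q + j)) = real ((2 * q choose (q + j)) * (q - j))"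
      by (simp only:)
    then have ratio: "?b (Suc j) = ?b j * ((real q - real j) / (real q + real j + 1))"
      using jq by (simp only: of_nat_mult of_nat_diff of_nat_Suc of_nat_add)
        (simp add: eq_divide_eq add_ac)
    have "1 - ?y \<le> (real q - real j) / (real q + real j + 1)"
    proof -
      have "(2 * real j + 1) / (real q + real j + 1) \<le> ?y"
        by (intro divide_left_mono) auto
      moreover have "(real q - real j) / (real q + real j + 1) = 1 - (2 * real j + 1) / (real q + real j + 1)"
        by (simp add: field_simps)
      ultimately show ?thesis by simp
    qed
    then have "(1 - ?x) * real (2 * q choose q) * (1 - ?y) \<le> ?b j * ((real q - real j) / (real q + real j + 1))"
      using Suc.IH \<open>?y \<le> 1\<close> by (intro mult_mono) auto
    moreover have "(1 - ?x - ?y) * real (2 * q choose q) \<le> (1 - ?x) * (1 - ?y) * real (2 * q choose q)"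
    proof (rule mult_right_mono)
      have "1 - u - v \<le> (1 - u) * (1 - v)" if "0 \<le> u" "0 \<le> v" for u v :: real
        using mult_nonneg_nonneg[OF that] by (simp add: algebra_simps)
      then show "1 - ?x - ?y \<le> (1 - ?x) * (1 - ?y)"
        using \<open>0 \<le> ?x\<close> \<open>0 \<le> ?y\<close> by blast
    qed simp
    ultimately show ?thesis
      unfolding xy ratio by (simp only: mult_ac)
  qed
qed simp

section \<open>Local and tail probabilities of the simple random walk\<close>

text \<open>
  The probability that a simple random walk is in \<open>U\<close> after \<open>n\<close> steps, written as a count: with \<open>a\<close>
  steps up, the walk is at \<open>2 * a - n\<close>.
\<close>

definition walk_prob :: "nat \<Rightarrow> real set \<Rightarrow> real" where
  "walk_prob n U = (\<Sum>a | a \<le> n \<and> 2 * real a - real n \<in> U. real (n choose a)) / 2 ^ n"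

lemma walk_prob_UNIV [simp]: "walk_prob n UNIV = 1"
proof -
  have "(\<Sum>a\<le>n. real (n choose a)) = 2 ^ n"
    using choose_row_sum[of n] by (metis of_nat_numeral of_nat_power of_nat_sum)
  then show ?thesis
    by (simp add: walk_prob_def atMost_def)
qed

lemma walk_prob_nonneg: "0 \<le> walk_prob n U"
  unfolding walk_prob_def by (intro divide_nonneg_nonneg sum_nonneg) auto

lemma walk_prob_mono: "U \<subseteq> V \<Longrightarrow> walk_prob n U \<le> walk_prob n V"
  unfolding walk_prob_def by (intro divide_right_mono sum_mono2) auto

lemma walk_prob_le_1: "walk_prob n U \<le> 1"
  using walk_prob_mono[of U UNIV n] by simp

lemma sum_lower_half_odd_row: "(\<Sum>a\<le>r. real (2 * r + 1 choose a)) = 2 ^ (2 * r)"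
  using binomial_r_part_sum[of r] by (metis of_nat_numeral of_nat_power of_nat_sum)

lemma walk_prob_odd_nonpos: "walk_prob (2 * r + 1) {..0} = 1 / 2"
proof -
  have "{a. a \<le> 2 * r + 1 \<and> 2 * real a - real (2 * r + 1) \<in> {..0}} = {..r}"
    by auto
  then have "walk_prob (2 * r + 1) {..0} = 2 ^ (2 * r) / 2 ^ (2 * r + 1)"
    by (simp only: walk_prob_def sum_lower_half_odd_row)
  then show ?thesis
    by simp
qed

text \<open>
  Half of the mass lies below 0. At most \<open>h\<close> atoms lie between \<open>- 2 * h\<close> and 0, each of mass at
  most \<open>1 / sqrt (2 * r + 2)\<close>; the bound on \<open>h\<close> makes their total mass at most 1/4.
\<close>

lemma walk_prob_lower_tail:
  assumes "real h \<le> sqrt (2 * real r + 2) / 4"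
  shows "1 / 4 \<le> walk_prob (2 * r + 1) {..- (2 * real h)}"
proof -
  let ?n = "2 * r + 1"
  let ?S = "{a. a \<le> ?n \<and> 2 * real a - real ?n \<in> {..- (2 * real h)}}" and ?R = "{Suc r - h..r}"
  let ?f = "\<lambda>a. real (?n choose a)"
  have "sum ?f ?R \<le> real (card ?R) * (2 ^ ?n / sqrt (real ?n + 1))"
    by (rule sum_bounded_above) (rule binomial_le_div_sqrt)
  also have "\<dots> \<le> real h * (2 ^ ?n / sqrt (real ?n + 1))"
    by (intro mult_right_mono) auto
  also have "\<dots> \<le> sqrt (2 * real r + 2) / 4 * (2 ^ ?n / sqrt (real ?n + 1))"
    using assms by (intro mult_right_mono) auto
  also have "\<dots> = 2 ^ ?n / 4"
    by (simp add: add_ac)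
  finally have R: "sum ?f ?R \<le> 2 ^ ?n / 4" .
  have "2 ^ ?n / 2 = sum ?f {..r}"
    unfolding sum_lower_half_odd_row by simp
  also have "\<dots> \<le> sum ?f (?S \<union> ?R)"
    by (rule sum_mono2) auto
  also have "\<dots> \<le> sum ?f (?S \<union> ?R) + sum ?f (?S \<inter> ?R)"
    by (simp add: sum_nonneg)
  also have "\<dots> = sum ?f ?S + sum ?f ?R"
    by (rule sum.union_inter) auto
  finally have "2 ^ ?n / 4 \<le> sum ?f ?S"
    using R by linarith
  then show ?thesis
    unfolding walk_prob_def by (subst pos_le_divide_eq) simp_all
qed

abbreviation window_prob :: "nat \<Rightarrow> nat \<Rightarrow> real" where
  "window_prob m h \<equiv> walk_prob m {0<..2 * real h}"

text \<open>
  The window contains exactly \<open>h\<close> points of the parity of \<open>m\<close>, and none of them is too heavy.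
\<close>

lemma window_prob_upper: "window_prob m h \<le> real h / sqrt (real m + 1)"
proof -
  let ?S = "{a. a \<le> m \<and> 2 * real a - real m \<in> {0<..2 * real h}}"
  \<comment> \<open>For either parity of \<open>m\<close>, these are the numbers of steps up that lead into the window.\<close>
  have "?S \<subseteq> {m div 2<..m div 2 + h}"
    by (auto; linarith)
  then have card: "card ?S \<le> h"
    using card_mono[of "{m div 2<..m div 2 + h}" ?S] by simp
  have "(\<Sum>a\<in>?S. real (m choose a)) \<le> real (card ?S) * (2 ^ m / sqrt (real m + 1))"
    by (intro sum_bounded_above binomial_le_div_sqrt)
  also have "\<dots> \<le> real h * (2 ^ m / sqrt (real m + 1))"
    using card by (intro mult_right_mono) auto
  finally show ?thesis
    by (simp add: walk_prob_def field_simps)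
qed

text \<open>
  As long as \<open>h\<close> is at most of the order of \<open>sqrt q\<close>, each of the \<open>h\<close> atoms in the window weighs at
  least half as much as the atom at 0.
\<close>

lemma window_prob_lower:
  assumes "1 \<le> q" and "2 * (real h)\<^sup>2 \<le> real q + 1"
  shows "real h / (4 * sqrt (real q)) \<le> window_prob (2 * q) h"
proof -
  let ?S = "{a. a \<le> 2 * q \<and> 2 * real a - real (2 * q) \<in> {0<..2 * real h}}"
  have half: "1 / 2 * (4 ^ q / (2 * sqrt (real q))) \<le> real (2 * q choose (q + j))" if "j \<in> {1..h}" for j
  proof -
    have "(real j)\<^sup>2 \<le> (real h)\<^sup>2"
      using that by (intro power_mono) auto
    then have "2 * (real j)\<^sup>2 \<le> real q + 1"
      using assms(2) by linarith
    then have "1 / 2 \<le> 1 - (real j)\<^sup>2 / (real q + 1)"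
      using assms(2) by (simp add: divide_le_eq pos_le_divide_eq)
    moreover have "4 ^ q / (2 * sqrt (real q)) \<le> real (2 * q choose q)"
      using central_binomial_lower[OF assms(1)] assms(1) by (simp add: divide_le_eq)
    ultimately have "1 / 2 * (4 ^ q / (2 * sqrt (real q)))
        \<le> (1 - (real j)\<^sup>2 / (real q + 1)) * real (2 * q choose q)"
      by (intro mult_mono) auto
    then show ?thesis
      using binomial_near_centre[of j q] by linarith
  qed
  \<comment> \<open>The top of the window is within reach of the walk, so that all \<open>h\<close> atoms exist.\<close>
  have "(real h)\<^sup>2 \<le> (real q)\<^sup>2"
    using assms mult_left_mono[of 1 "real q" "real q"] unfolding power2_eq_square by linarith
  then have "h \<le> q"
    by (simp add: power2_le_iff_abs_le)
  then have sub: "(\<lambda>j. q + j) ` {1..h} \<subseteq> ?S"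
    by auto
  have "real (card {1..h}) * (1 / 2 * (4 ^ q / (2 * sqrt (real q))))
      \<le> (\<Sum>j\<in>{1..h}. real (2 * q choose (q + j)))"
    by (rule sum_bounded_below) (rule half)
  also have "\<dots> = (\<Sum>a\<in>(\<lambda>j. q + j) ` {1..h}. real (2 * q choose a))"
    by (subst sum.reindex) auto
  also have "\<dots> \<le> (\<Sum>a\<in>?S. real (2 * q choose a))"
    using sub by (intro sum_mono2) auto
  finally have "real h * 4 ^ q / (4 * sqrt (real q)) \<le> (\<Sum>a\<in>?S. real (2 * q choose a))"
    by simp
  moreover have "(4::real) ^ q = 2 ^ (2 * q)"
    by (simp add: power_mult)
  ultimately show ?thesis
    unfolding walk_prob_def by (subst pos_le_divide_eq) (simp_all add: mult.commute)
qed

section \<open>Independent fair signs\<close>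

text \<open>
  Subsets of \<^term>\<open>{1..n}\<close>, the places of the signs \<open>+1\<close>, parametrise the sample points, so that
  probabilities reduce to counting subsets of given size.
\<close>

definition fair_signs :: "nat \<Rightarrow> (nat \<Rightarrow> real) pmf" where
  "fair_signs n = map_pmf (\<lambda>T i. if i \<in> T then 1 else -1) (pmf_of_set (Pow {1..n}))"

lemma set_fair_signs: "set_pmf (fair_signs n) = (\<lambda>T i. if i \<in> T then 1 else -1) ` Pow {1..n}"
  unfolding fair_signs_def set_map_pmf by (subst set_pmf_of_set) auto

lemma finite_set_fair_signs [simp]: "finite (set_pmf (fair_signs n))"
  by (simp add: set_fair_signs)

lemma fair_signs_cases: "\<omega> \<in> set_pmf (fair_signs n) \<Longrightarrow> \<omega> i = 1 \<or> \<omega> i = -1"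
  by (auto simp: set_fair_signs split: if_splits)

lemma integrable_fair_signs [simp]: "integrable (measure_pmf (fair_signs n)) (f :: _ \<Rightarrow> real)"
  by (rule integrable_measure_pmf_finite) simp

definition flip_sign :: "nat \<Rightarrow> (nat \<Rightarrow> real) \<Rightarrow> nat \<Rightarrow> real" where
  "flip_sign i \<omega> j = (if j = i then - \<omega> j else \<omega> j)"

text \<open>
  On subsets, a flip adds or removes one element. This symmetry is what makes martingale differences out of
  signs that are only switched off by the past.
\<close>

lemma fair_signs_flip:
  assumes "i \<in> {1..n}"
  shows "map_pmf (flip_sign i) (fair_signs n) = fair_signs n"
proof -
  let ?s = "\<lambda>T i. if i \<in> T then 1 else -1 :: real"
  let ?t = "\<lambda>T. if i \<in> T then T - {i} else insert i T"
  have "bij_betw ?t (Pow {1..n}) (Pow {1..n})"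
    using assms by (intro bij_betwI[where g = ?t]) (auto split: if_splits)
  then have "map_pmf ?t (pmf_of_set (Pow {1..n})) = pmf_of_set (Pow {1..n})"
    by (intro map_pmf_of_set_bij_betw) auto
  moreover have "flip_sign i \<circ> ?s = ?s \<circ> ?t"
    by (auto simp: fun_eq_iff flip_sign_def)
  ultimately show ?thesis
    by (simp add: fair_signs_def pmf.map_comp) (metis pmf.map_comp)
qed

lemma expectation_fair_signs_flip:
  fixes f :: "(nat \<Rightarrow> real) \<Rightarrow> real"
  assumes "i \<in> {1..n}"
  shows "measure_pmf.expectation (fair_signs n) f
    = measure_pmf.expectation (fair_signs n) (\<lambda>\<omega>. f (flip_sign i \<omega>))"
  using integral_map_pmf[of "flip_sign i" "fair_signs n" f] fair_signs_flip[OF assms] by simp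

lemma card_subsets_by_size:
  assumes "finite I"
  shows "card {T. T \<subseteq> I \<and> card T \<in> B} = (\<Sum>a | a \<le> card I \<and> a \<in> B. card I choose a)"
proof -
  have "{T. T \<subseteq> I \<and> card T \<in> B} = (\<Union>a \<in> {a. a \<le> card I \<and> a \<in> B}. {T. T \<subseteq> I \<and> card T = a})"
    using assms by (auto intro: card_mono)
  also have "card \<dots> = (\<Sum>a | a \<le> card I \<and> a \<in> B. card {T. T \<subseteq> I \<and> card T = a})"
    using assms by (intro card_UN_disjoint) auto
  also have "\<dots> = (\<Sum>a | a \<le> card I \<and> a \<in> B. card I choose a)"
    using assms by (intro sum.cong) (auto simp: n_subsets)
  finally show ?thesis .
qed

lemma sum_signs:
  assumes "finite I"
  shows "(\<Sum>j\<in>I. if j \<in> T then 1 else -1) = 2 * real (card (T \<inter> I)) - real (card I)"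
proof -
  have "(\<Sum>j\<in>I. if j \<in> T then 1 else -1) = (\<Sum>j\<in>I. 2 * indicator T j - (1::real))"
    by (intro sum.cong) (auto simp: indicator_def)
  also have "\<dots> = 2 * real (card (T \<inter> I)) - real (card I)"
    using assms by (simp add: sum_subtractf indicator_def Int_commute flip: sum_distrib_left sum.inter_restrict)
  finally show ?thesis .
qed

text \<open>
  The sums over two consecutive blocks of signs are independent simple random walks: a subset of
  \<^term>\<open>{1..n}\<close> is a pair consisting of a subset of each block.
\<close>

lemma prob_fair_signs_blocks:
  assumes "m \<le> n"
  shows "measure (fair_signs n)
      {\<omega>. (\<Sum>j=1..m. \<omega> j) \<in> U \<and> (\<Sum>j=Suc m..n. \<omega> j) \<in> V}
    = walk_prob m U * walk_prob (n - m) V"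
proof -
  define B where "B = {a. 2 * real a - real m \<in> U}"
  define C where "C = {b. 2 * real b - real (n - m) \<in> V}"
  let ?I = "{1..m}" and ?J = "{Suc m..n}"
  let ?E = "{T. T \<subseteq> {1..n} \<and> card (T \<inter> ?I) \<in> B \<and> card (T \<inter> ?J) \<in> C}"
  let ?P = "{T. T \<subseteq> ?I \<and> card T \<in> B} \<times> {T. T \<subseteq> ?J \<and> card T \<in> C}"
  have "measure (fair_signs n) {\<omega>. (\<Sum>j=1..m. \<omega> j) \<in> U \<and> (\<Sum>j=Suc m..n. \<omega> j) \<in> V}
      = measure (pmf_of_set (Pow {1..n})) {T. card (T \<inter> ?I) \<in> B \<and> card (T \<inter> ?J) \<in> C}"
    unfolding fair_signs_def by (simp add: vimage_def sum_signs B_def C_def)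
  also have "\<dots> = real (card (Pow {1..n} \<inter> {T. card (T \<inter> ?I) \<in> B \<and> card (T \<inter> ?J) \<in> C})) / 2 ^ n"
    by (subst measure_pmf_of_set) (auto simp: card_Pow)
  also have "Pow {1..n} \<inter> {T. card (T \<inter> ?I) \<in> B \<and> card (T \<inter> ?J) \<in> C} = ?E"
    by auto
  also have "card ?E = card ?P"
  proof (rule bij_betw_same_card[of "\<lambda>T. (T \<inter> ?I, T \<inter> ?J)"], rule bij_betwI[where g = "\<lambda>(T, T'). T \<union> T'"])
    show "(\<lambda>(T, T'). T \<union> T') \<in> ?P \<rightarrow> ?E"
    proof (rule Pi_I)
      fix y assume "y \<in> ?P"
      then obtain T T' where y: "y = (T, T')" and T: "T \<subseteq> ?I" "T' \<subseteq> ?J" "card T \<in> B" "card T' \<in> C"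
        by auto
      then have "(T \<union> T') \<inter> ?I = T" "(T \<union> T') \<inter> ?J = T'" "T \<union> T' \<subseteq> {1..n}"
        using assms by fastforce+
      then show "(case y of (T, T') \<Rightarrow> T \<union> T') \<in> ?E"
        using T y by simp
    qed
  next
    show "(case (T \<inter> ?I, T \<inter> ?J) of (T, T') \<Rightarrow> T \<union> T') = T" if "T \<in> ?E" for T
      using that by fastforce
  next
    show "(\<lambda>T. (T \<inter> ?I, T \<inter> ?J)) (case y of (T, T') \<Rightarrow> T \<union> T') = y" if "y \<in> ?P" for y
      using that assms by fastforce
  qed auto
  also have "card ?P = (\<Sum>a | a \<le> m \<and> a \<in> B. m choose a) * (\<Sum>a | a \<le> n - m \<and> a \<in> C. (n - m) choose a)"
    by (simp add: card_cartesian_product card_subsets_by_size)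
  finally show ?thesis
    using assms by (simp add: walk_prob_def B_def C_def flip: power_add)
qed

section \<open>Conditioning on the past\<close>

lemma sets_gen_filt:
  "sets (gen_filt M X i)
    = sigma_sets (space M) {X j -` A \<inter> space M | j A. j \<in> {1..i} \<and> A \<in> sets borel}"
  unfolding gen_filt_def by (rule sets_measure_of) auto

lemma space_gen_filt [simp]: "space (gen_filt M X i) = space M"
  unfolding gen_filt_def by (rule space_measure_of) auto

lemma measurable_gen_filt:
  assumes "j \<in> {1..i}"
  shows "X j \<in> borel_measurable (gen_filt M X i)"
  using assms by (intro measurableI) (auto simp: sets_gen_filt intro!: sigma_sets.Basic)

text \<open>
  A map that leaves \<open>X 1, ..., X i\<close> unchanged cannot be seen by the events that they generate.
\<close>

lemma gen_filt_invariant: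
  assumes "A \<in> sets (gen_filt M X i)" and "space M = UNIV"
    and "\<And>j \<omega>. j \<in> {1..i} \<Longrightarrow> X j (\<tau> \<omega>) = X j \<omega>"
  shows "\<tau> \<omega> \<in> A \<longleftrightarrow> \<omega> \<in> A"
  using assms(1) unfolding sets_gen_filt
proof (induction arbitrary: \<omega> rule: sigma_sets.induct)
  case (Basic a)
  then show ?case using assms by auto
qed (use assms in auto)

lemma subalgebra_gen_filt_pmf: "subalgebra (measure_pmf M) (gen_filt (measure_pmf M) X i)"
  unfolding subalgebra_def by simp

lemma sigma_finite_subalgebra_gen_filt_pmf:
  "sigma_finite_subalgebra (measure_pmf M) (gen_filt (measure_pmf M) X i)"
  by (intro finite_measure_subalgebra_is_sigma_finite finite_measure_subalgebra.intro
      finite_measure_subalgebra_axioms.intro measure_pmf.finite_measure subalgebra_gen_filt_pmf)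

text \<open>
  If flipping sign \<open>i\<close> preserves the past and reverses \<open>X i\<close>, then the integral of \<open>X i\<close> over each past
  event equals its own negative.
\<close>

lemma cond_exp_fair_signs_eq_0:
  assumes "i \<in> {1..n}"
    and past: "\<And>j \<omega>. j \<in> {1..i - 1} \<Longrightarrow> X j (flip_sign i \<omega>) = X j \<omega>"
    and current: "\<And>\<omega>. X i (flip_sign i \<omega>) = - X i \<omega>"
  shows "AE \<omega> in fair_signs n.
    real_cond_exp (fair_signs n) (gen_filt (fair_signs n) X (i - 1)) (X i) \<omega> = 0"
proof -
  let ?M = "measure_pmf (fair_signs n)"
  interpret sigma_finite_subalgebra ?M "gen_filt ?M X (i - 1)"
    by (rule sigma_finite_subalgebra_gen_filt_pmf)
  show ?thesis
  proof (rule real_cond_exp_charact)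
    fix A assume A: "A \<in> sets (gen_filt ?M X (i - 1))"
    have inv: "flip_sign i \<omega> \<in> A \<longleftrightarrow> \<omega> \<in> A" for \<omega>
      using gen_filt_invariant[OF A, of "flip_sign i"] past by simp
    have "(\<integral>\<omega>\<in>A. X i \<omega> \<partial>?M) = (\<integral>\<omega>. indicator A (flip_sign i \<omega>) *\<^sub>R X i (flip_sign i \<omega>) \<partial>?M)"
      unfolding set_lebesgue_integral_def by (rule expectation_fair_signs_flip[OF assms(1)])
    also have "\<dots> = - (\<integral>\<omega>\<in>A. X i \<omega> \<partial>?M)"
      unfolding set_lebesgue_integral_def by (simp add: inv current indicator_def)
    finally show "(\<integral>\<omega>\<in>A. X i \<omega> \<partial>?M) = (\<integral>\<omega>\<in>A. 0 \<partial>?M)"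
      by (simp add: set_lebesgue_integral_def)
  qed auto
qed

section \<open>The walk stopped in a window\<close>

definition in_window :: "nat \<Rightarrow> nat \<Rightarrow> (nat \<Rightarrow> real) \<Rightarrow> bool" where
  "in_window m h \<omega> \<longleftrightarrow> (\<Sum>j=1..m. \<omega> j) \<in> {0<..2 * real h}"

text \<open>
  Partial sums of these variables follow the simple random walk until time \<open>m\<close>; if the walk is then in
  the window, it stays where it is for ever.
\<close>

definition stopped_signs :: "nat \<Rightarrow> nat \<Rightarrow> nat \<Rightarrow> (nat \<Rightarrow> real) \<Rightarrow> real" where
  "stopped_signs m h i \<omega> = (if m < i \<and> in_window m h \<omega> then 0 else \<omega> i)"

lemma in_window_flip: "m < i \<Longrightarrow> in_window m h (flip_sign i \<omega>) = in_window m h \<omega>"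
proof -
  assume "m < i"
  then have "(\<Sum>j=1..m. flip_sign i \<omega> j) = (\<Sum>j=1..m. \<omega> j)"
    by (intro sum.cong) (auto simp: flip_sign_def)
  then show ?thesis by (simp add: in_window_def)
qed

lemma mart_diff_seq_stopped_signs: "mart_diff_seq (fair_signs n) n (stopped_signs m h)"
  unfolding mart_diff_seq_def
proof (intro conjI ballI)
  fix i assume "i \<in> {1..n}"
  then show "AE \<omega> in fair_signs n. real_cond_exp (fair_signs n)
      (gen_filt (fair_signs n) (stopped_signs m h) (i - 1)) (stopped_signs m h i) \<omega> = 0"
  proof (rule cond_exp_fair_signs_eq_0)
    show "stopped_signs m h j (flip_sign i \<omega>) = stopped_signs m h j \<omega>" if "j \<in> {1..i - 1}" for j \<omega>
    proof -
      have "m < j \<Longrightarrow> in_window m h (flip_sign i \<omega>) = in_window m h \<omega>"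
        using that by (intro in_window_flip) auto
      then show ?thesis
        using that by (auto simp: stopped_signs_def flip_sign_def[of i \<omega> j])
    qed
    show "stopped_signs m h i (flip_sign i \<omega>) = - stopped_signs m h i \<omega>" for \<omega>
      using in_window_flip[of m i h \<omega>] by (auto simp: stopped_signs_def flip_sign_def)
  qed
qed (auto simp: prob_space_measure_pmf)

lemma stopped_signs_square:
  assumes "\<omega> \<in> set_pmf (fair_signs n)"
  shows "(stopped_signs m h i \<omega>)\<^sup>2 = (if m < i \<and> in_window m h \<omega> then 0 else 1)"
  using fair_signs_cases[OF assms, of i] by (auto simp: stopped_signs_def)

text \<open>
  The square of the increment is 0 or 1, and the walk at time \<open>m\<close> tells which. Hence it is already known
  one step ahead, and the conditional variances of the walk are plain indicators.
\<close>

lemma cond_exp_stopped_signs_square: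
  "AE \<omega> in fair_signs n. real_cond_exp (fair_signs n)
     (gen_filt (fair_signs n) (stopped_signs m h) (i - 1)) (\<lambda>\<omega>. (stopped_signs m h i \<omega>)\<^sup>2) \<omega>
     = (stopped_signs m h i \<omega>)\<^sup>2"
proof -
  let ?M = "measure_pmf (fair_signs n)" and ?X = "stopped_signs m h"
  let ?F = "gen_filt ?M ?X (i - 1)"
  let ?c = "\<lambda>\<omega>. if m < i \<and> in_window m h \<omega> then 0 else 1 :: real"
  interpret sigma_finite_subalgebra ?M ?F
    by (rule sigma_finite_subalgebra_gen_filt_pmf)
  have eq: "AE \<omega> in ?M. (?X i \<omega>)\<^sup>2 = ?c \<omega>"
    by (auto simp: AE_measure_pmf_iff stopped_signs_square)
  have meas: "?c \<in> borel_measurable ?F"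
  proof (cases "m < i")
    case True
    \<comment> \<open>Up to time \<open>m\<close> the variables are the signs themselves, so that they determine the window event.\<close>
    have "(\<lambda>\<omega>. \<Sum>j=1..m. ?X j \<omega>) \<in> borel_measurable ?F"
      using True by (intro borel_measurable_sum measurable_gen_filt) auto
    then have [measurable]: "(\<lambda>\<omega>. \<Sum>j=1..m. \<omega> j) \<in> borel_measurable ?F"
      by (simp add: stopped_signs_def)
    show ?thesis
      unfolding in_window_def by measurable
  qed simp
  have "AE \<omega> in ?M. real_cond_exp ?M ?F (\<lambda>\<omega>. (?X i \<omega>)\<^sup>2) \<omega> = real_cond_exp ?M ?F ?c \<omega>"
    using eq by (intro real_cond_exp_cong) auto
  moreover have "AE \<omega> in ?M. real_cond_exp ?M ?F ?c \<omega> = ?c \<omega>"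
    by (rule real_cond_exp_F_meas[OF integrable_fair_signs meas])
  ultimately show ?thesis
    using eq by eventually_elim simp
qed

lemma sum_stopped_signs_square:
  assumes "\<omega> \<in> set_pmf (fair_signs n)" and "m \<le> n"
  shows "(\<Sum>i=1..n. (stopped_signs m h i \<omega>)\<^sup>2)
    = real n - real (n - m) * indicator {\<omega>. in_window m h \<omega>} \<omega>"
proof -
  have "(\<Sum>i=1..n. (stopped_signs m h i \<omega>)\<^sup>2)
      = (\<Sum>i=1..n. 1 - (if i \<in> {Suc m..n} then indicator {\<omega>. in_window m h \<omega>} \<omega> else 0))"
    by (intro sum.cong) (auto simp: stopped_signs_square[OF assms(1)] indicator_def)
  also have "\<dots> = real n - (\<Sum>i\<in>{Suc m..n}. indicator {\<omega>. in_window m h \<omega>} \<omega>)"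
    by (subst sum_subtractf, subst sum.inter_restrict[symmetric]) (auto intro!: sum.cong)
  finally show ?thesis by simp
qed

lemma prob_in_window:
  assumes "m \<le> n"
  shows "measure (fair_signs n) {\<omega>. in_window m h \<omega>} = window_prob m h"
  using prob_fair_signs_blocks[OF assms, of "{0<..2 * real h}" UNIV] by (simp add: in_window_def)

lemma mds_s2_stopped_signs:
  assumes "m \<le> n"
  shows "mds_s2 (fair_signs n) n (stopped_signs m h) = real n - real (n - m) * window_prob m h"
proof -
  let ?M = "measure_pmf (fair_signs n)"
  have "mds_s2 ?M n (stopped_signs m h) = (\<integral>\<omega>. (\<Sum>i=1..n. (stopped_signs m h i \<omega>)\<^sup>2) \<partial>?M)"
    unfolding mds_s2_def by (rule Bochner_Integration.integral_sum[symmetric]) simp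
  also have "\<dots> = (\<integral>\<omega>. real n - real (n - m) * indicator {\<omega>. in_window m h \<omega>} \<omega> \<partial>?M)"
    using assms by (intro integral_cong_AE) (auto simp: AE_measure_pmf_iff sum_stopped_signs_square simp del: One_nat_def)
  also have "\<dots> = real n - real (n - m) * window_prob m h"
    by (subst Bochner_Integration.integral_diff) (auto simp: prob_in_window[OF assms])
  finally show ?thesis .
qed

lemma mds_V2_stopped_signs:
  assumes "m \<le> n"
  shows "AE \<omega> in fair_signs n. mds_V2 (fair_signs n) n (stopped_signs m h) \<omega>
    = (real n - real (n - m) * indicator {\<omega>. in_window m h \<omega>} \<omega>)
      / mds_s2 (fair_signs n) n (stopped_signs m h)"
proof -
  have "AE \<omega> in fair_signs n. \<forall>i\<in>{1..n}. real_cond_exp (fair_signs n)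
     (gen_filt (fair_signs n) (stopped_signs m h) (i - 1)) (\<lambda>\<omega>. (stopped_signs m h i \<omega>)\<^sup>2) \<omega>
     = (stopped_signs m h i \<omega>)\<^sup>2"
    by (intro AE_finite_allI cond_exp_stopped_signs_square) simp
  then show ?thesis
    by (auto simp: AE_measure_pmf_iff mds_V2_def simp flip: sum_stopped_signs_square[OF _ assms])
qed

lemma seq_norm_stopped_signs_le:
  assumes "1 \<le> n"
  shows "seq_norm (fair_signs n) \<infinity> n (stopped_signs m h) \<le> 2"
proof -
  have "Lp_norm (fair_signs n) \<infinity> (stopped_signs m h i) \<le> 2" for i
  proof -
    have "ennreal \<bar>stopped_signs m h i \<omega>\<bar> \<le> 2" if "\<omega> \<in> set_pmf (fair_signs n)" for \<omega>
      using fair_signs_cases[OF that, of i] by (auto simp: stopped_signs_def)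
    then show ?thesis
      unfolding Lp_norm_def by (auto intro!: esssup_I simp: AE_measure_pmf_iff)
  qed
  then show ?thesis
    using assms by (auto simp: seq_norm_def)
qed

lemma Lp_norm_leI:
  assumes "1 \<le> p" and "0 \<le> B" and "(\<integral>\<^sup>+\<omega>. ennreal (\<bar>Y \<omega>\<bar> powr p) \<partial>M) \<le> ennreal B"
  shows "Lp_norm M (ennreal p) Y \<le> ennreal (B powr (1 / p))"
proof -
  let ?I = "\<integral>\<^sup>+\<omega>. ennreal (\<bar>Y \<omega>\<bar> powr p) \<partial>M"
  have "?I \<noteq> \<infinity>"
    using assms(3) by (auto simp: top_unique)
  moreover have "enn2real ?I \<le> B"
    using assms by (metis enn2real_leI)
  ultimately show ?thesis
    using assms by (simp add: Lp_norm_def Let_def ennreal_leI powr_mono2)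
qed

text \<open>
  With \<open>k = n - m\<close> and window probability \<open>\<mu>\<close>, the deviation \<open>V\<^sup>2 - 1\<close> is
  \<open>k * (\<mu> - 1) / s\<^sup>2\<close> in the window and \<open>k * \<mu> / s\<^sup>2\<close> outside, where \<open>s\<^sup>2 \<ge> n / 2\<close>. Its
  \<open>p\<close>-th moment is thus at most \<open>(2 * k / n) powr p\<close> times \<open>\<mu> + \<mu> powr p\<close>, and \<open>\<mu> powr p \<le> \<mu>\<close>
  because \<open>p \<ge> 1\<close>.
\<close>

lemma Lp_norm_V2_le:
  assumes "m \<le> n" and "1 \<le> p" and "2 * (n - m) \<le> n" and "1 \<le> n"
  shows "Lp_norm (fair_signs n) (ennreal p) (\<lambda>\<omega>. mds_V2 (fair_signs n) n (stopped_signs m h) \<omega> - 1)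
    \<le> ennreal ((2 * window_prob m h * (2 * real (n - m) / real n) powr p) powr (1 / p))"
proof (rule Lp_norm_leI)
  let ?M = "measure_pmf (fair_signs n)" and ?A = "{\<omega>. in_window m h \<omega>}"
  let ?V = "mds_V2 (fair_signs n) n (stopped_signs m h)"
  define \<mu> where "\<mu> = window_prob m h"
  define k where "k = real (n - m)"
  define s where "s = real n - k * \<mu>"
  define x where "x = 2 * k / real n"
  have \<mu>: "\<mu> = measure ?M ?A"
    using prob_in_window[OF assms(1)] by (simp add: \<mu>_def)
  have \<mu>01: "0 \<le> \<mu>" "\<mu> \<le> 1"
    unfolding \<mu> by simp_all
  have k: "0 \<le> k" "2 * k \<le> real n"
    using assms(3) by (simp_all add: k_def)
  have k\<mu>: "0 \<le> k * \<mu>" "k * \<mu> \<le> k"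
    using \<mu>01 k by (auto simp: mult_left_le)
  then have s: "real n / 2 \<le> s" "0 < s"
    using k assms(4) by (simp_all add: s_def)
  have x: "0 \<le> x" using k by (simp add: x_def)
  have bound: "\<bar>?V \<omega> - 1\<bar> powr p \<le> x powr p * indicator ?A \<omega> + (\<mu> * x) powr p"
    if V: "?V \<omega> = (real n - k * indicator ?A \<omega>) / s" for \<omega>
  proof -
    have "\<bar>?V \<omega> - 1\<bar> = \<bar>k * (\<mu> - indicator ?A \<omega>)\<bar> / s"
    proof -
      have "?V \<omega> - 1 = (real n - k * indicator ?A \<omega> - s) / s"
        using s(2) by (simp only: V diff_divide_distrib) simp
      also have "real n - k * indicator ?A \<omega> - s = k * (\<mu> - indicator ?A \<omega>)"
        by (simp only: s_def right_diff_distrib)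
      finally show ?thesis
        using s(2) by simp
    qed
    also have "\<dots> \<le> \<bar>k * (\<mu> - indicator ?A \<omega>)\<bar> / (real n / 2)"
      using s assms(4) by (intro divide_left_mono) auto
    also have "\<dots> = x * \<bar>\<mu> - indicator ?A \<omega>\<bar>"
      using k by (simp add: x_def abs_mult)
    also have "\<dots> \<le> x * (if \<omega> \<in> ?A then 1 else \<mu>)"
      using x \<mu>01 by (intro mult_left_mono) auto
    finally have "\<bar>?V \<omega> - 1\<bar> powr p \<le> (x * (if \<omega> \<in> ?A then 1 else \<mu>)) powr p"
      using assms(2) by (intro powr_mono2) auto
    then show ?thesis
      by (cases "\<omega> \<in> ?A") (auto simp: mult.commute add_increasing2)
  qed
  have "(\<integral>\<^sup>+\<omega>. ennreal (\<bar>?V \<omega> - 1\<bar> powr p) \<partial>?M)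
      \<le> (\<integral>\<^sup>+\<omega>. ennreal (x powr p * indicator ?A \<omega> + (\<mu> * x) powr p) \<partial>?M)"
  proof (rule nn_integral_mono_AE)
    have "AE \<omega> in ?M. ?V \<omega> = (real n - k * indicator ?A \<omega>) / s"
      using mds_V2_stopped_signs[OF assms(1), of h]
      by (simp only: mds_s2_stopped_signs[OF assms(1)] k_def \<mu>_def s_def)
    then show "AE \<omega> in ?M. ennreal (\<bar>?V \<omega> - 1\<bar> powr p)
        \<le> ennreal (x powr p * indicator ?A \<omega> + (\<mu> * x) powr p)"
      by eventually_elim (intro ennreal_leI bound)
  qed
  also have "\<dots> = ennreal (\<integral>\<omega>. x powr p * indicator ?A \<omega> + (\<mu> * x) powr p \<partial>?M)"
    by (intro nn_integral_eq_integral) auto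
  also have "(\<integral>\<omega>. x powr p * indicator ?A \<omega> + (\<mu> * x) powr p \<partial>?M) = x powr p * \<mu> + (\<mu> * x) powr p"
    by (subst Bochner_Integration.integral_add) (auto simp: \<mu>)
  also have "(\<mu> * x) powr p \<le> \<mu> * x powr p"
  proof -
    have "\<mu> powr p \<le> \<mu> powr 1"
      by (rule powr_mono') (use \<mu>01 assms(2) in auto)
    then show ?thesis
      using \<mu>01 x by (simp add: powr_mult mult_right_mono)
  qed
  finally show "(\<integral>\<^sup>+\<omega>. ennreal (\<bar>?V \<omega> - 1\<bar> powr p) \<partial>?M)
      \<le> ennreal (2 * window_prob m h * (2 * real (n - m) / real n) powr p)"
    by (simp add: \<mu>_def k_def x_def algebra_simps ennreal_leI)
qed (use assms in \<open>simp_all add: walk_prob_nonneg\<close>)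

section \<open>Distance to the normal law at zero\<close>

text \<open>
  Substituting \<open>- x / sqrt 2\<close> for the variable turns the Gaussian integral over the positive half-line
  into this one.
\<close>

lemma Phi_0: "Phi 0 = 1 / 2"
proof -
  have "has_bochner_integral lborel (\<lambda>x. indicator {0..} x *\<^sub>R exp (- x\<^sup>2)) (sqrt pi / 2 :: real)"
    by (rule gaussian_moment_0)
  then have "(\<integral>x. indicator {0..} x * exp (- x\<^sup>2) \<partial>lborel) = sqrt pi / 2"
    by (simp add: has_bochner_integral_iff)
  also have "(\<integral>x. indicator {0..} x * exp (- x\<^sup>2) \<partial>lborel)
      = (1 / sqrt 2) * (\<integral>x. indicator {0..} (- (1 / sqrt 2) * x) * exp (- (- (1 / sqrt 2) * x)\<^sup>2) \<partial>lborel)"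
    by (subst lborel_integral_real_affine[where c = "- (1 / sqrt 2)" and t = 0]) auto
  also have "(\<integral>x. indicator {0..} (- (1 / sqrt 2) * x) * exp (- (- (1 / sqrt 2) * x)\<^sup>2) \<partial>lborel)
      = (LINT x:{..0}|lborel. exp (- x\<^sup>2 / 2))"
    unfolding set_lebesgue_integral_def
    by (intro Bochner_Integration.integral_cong)
      (auto simp: indicator_def power_divide zero_le_mult_iff divide_le_0_iff)
  finally have "(LINT x:{..0::real}|lborel. exp (- x\<^sup>2 / 2)) = sqrt pi / 2 * sqrt 2"
    by (simp add: field_simps)
  then show ?thesis
    by (simp add: Phi_def real_sqrt_mult)
qed

text \<open>
  The distribution functions are compared at 0, where dividing by \<open>s\<close> has no effect. In the window the
  stopped walk ends above 0; elsewhere it agrees with the plain walk, which for odd \<open>n\<close> ends below 0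
  with probability exactly \<open>1 / 2 = \<Phi>(0)\<close>. The discrepancy at 0 is therefore the probability that the
  plain walk visits the window at time \<open>2 * q\<close> and ends below 0. This happens in particular if the
  remaining steps lead down by at least \<open>2 * h\<close>.
\<close>

lemma mds_D_stopped_signs_lower:
  assumes h: "real h \<le> sqrt (2 * real r + 2) / 4" and n: "n = 2 * q + (2 * r + 1)"
    and s: "0 < mds_s (fair_signs n) n (stopped_signs (2 * q) h)"
  shows "window_prob (2 * q) h / 4 \<le> mds_D (fair_signs n) n (stopped_signs (2 * q) h)"
proof -
  let ?m = "2 * q" and ?M = "measure_pmf (fair_signs n)" and ?X = "stopped_signs (2 * q) h"
  let ?A = "{\<omega>. in_window ?m h \<omega>}"
  let ?W = "{\<omega>. (\<Sum>j=1..n. \<omega> j) \<le> 0}"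
  have nm: "n - ?m = 2 * r + 1" "?m \<le> n"
    using n by simp_all
  have split: "(\<Sum>j=1..n. f j) = (\<Sum>j=1..?m. f j) + (\<Sum>j=Suc ?m..n. f j)" for f :: "nat \<Rightarrow> real"
    using nm(2) sum.ub_add_nat[of 1 ?m f "n - ?m"] by simp
  have S: "mds_S n ?X \<omega> \<le> 0 \<longleftrightarrow> \<omega> \<in> ?W - ?A" for \<omega>
  proof -
    have "(\<Sum>j=1..?m. ?X j \<omega>) = (\<Sum>j=1..?m. \<omega> j)"
      by (simp add: stopped_signs_def)
    moreover have "(\<Sum>j=Suc ?m..n. ?X j \<omega>) = (if \<omega> \<in> ?A then 0 else \<Sum>j=Suc ?m..n. \<omega> j)"
      by (simp add: stopped_signs_def)
    ultimately show ?thesis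
      unfolding mds_S_def split by (auto simp: in_window_def)
  qed
  have "{\<omega> \<in> space ?M. mds_S n ?X \<omega> / mds_s ?M n ?X \<le> 0} = ?W - ?A"
    using s by (auto simp: divide_le_0_iff S)
  then have "measure ?M {\<omega> \<in> space ?M. mds_S n ?X \<omega> / mds_s ?M n ?X \<le> 0}
      = measure ?M ?W - measure ?M (?W \<inter> ?A)"
    by (simp add: measure_pmf.finite_measure_Diff')
  moreover have "measure ?M ?W = 1 / 2"
  proof -
    have "n = 2 * (q + r) + 1" using n by simp
    \<comment> \<open>The whole walk is a first block with an empty second one.\<close>
    then show ?thesis
      using prob_fair_signs_blocks[of n n "{..0}" UNIV] walk_prob_odd_nonpos[of "q + r"] by simp
  qed
  moreover have "window_prob ?m h / 4 \<le> measure ?M (?W \<inter> ?A)"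
  proof -
    have "window_prob ?m h / 4 \<le> window_prob ?m h * walk_prob (2 * r + 1) {..- (2 * real h)}"
      using mult_left_mono[OF walk_prob_lower_tail[OF h] walk_prob_nonneg[of ?m "{0<..2 * real h}"]] by simp
    also have "\<dots> = measure ?M {\<omega>. (\<Sum>j=1..?m. \<omega> j) \<in> {0<..2 * real h}
        \<and> (\<Sum>j=Suc ?m..n. \<omega> j) \<in> {..- (2 * real h)}}"
      by (simp only: prob_fair_signs_blocks[OF nm(2)] nm(1))
    also have "\<dots> \<le> measure ?M (?W \<inter> ?A)"
      by (intro measure_pmf.finite_measure_mono) (auto simp: in_window_def split simp del: One_nat_def)
    finally show ?thesis .
  qed
  moreover have "\<bar>measure ?M {\<omega> \<in> space ?M. mds_S n ?X \<omega> / mds_s ?M n ?X \<le> 0} - Phi 0\<bar> \<le> mds_D ?M n ?X"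
    unfolding mds_D_def by (intro cSUP_upper bdd_above_mds_D prob_space_measure_pmf) simp
  ultimately show ?thesis
    by (simp add: Phi_0)
qed

section \<open>Choice of the parameters\<close>

text \<open>
  The number \<open>2 * half_length \<alpha> n + 1\<close> of steps after the start time is odd, so that the
  start time is even whenever \<open>n\<close> is odd.
\<close>

definition half_length :: "real \<Rightarrow> nat \<Rightarrow> nat" where
  "half_length \<alpha> n = nat \<lfloor>real n powr \<alpha>\<rfloor>"

definition start_time :: "real \<Rightarrow> nat \<Rightarrow> nat" where
  "start_time \<alpha> n = n - (2 * half_length \<alpha> n + 1)"

text \<open>
  The largest height to which \<open>walk_prob_lower_tail\<close> applies: from anywhere in the window, the
  remaining steps then lead to 0 or below with probability at least 1/4.
\<close>

definition window_height :: "real \<Rightarrow> nat \<Rightarrow> nat" where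
  "window_height \<alpha> n = nat \<lfloor>sqrt (2 * real (half_length \<alpha> n) + 2) / 4\<rfloor>"

abbreviation window_mass :: "real \<Rightarrow> nat \<Rightarrow> real" where
  "window_mass \<alpha> n \<equiv> window_prob (start_time \<alpha> n) (window_height \<alpha> n)"

abbreviation window_stopped :: "real \<Rightarrow> nat \<Rightarrow> nat \<Rightarrow> (nat \<Rightarrow> real) \<Rightarrow> real" where
  "window_stopped \<alpha> n \<equiv> stopped_signs (start_time \<alpha> n) (window_height \<alpha> n)"

lemma window_height_le: "real (window_height \<alpha> n) \<le> sqrt (2 * real (half_length \<alpha> n) + 2) / 4"
  unfolding window_height_def by (rule of_nat_floor) simp

lemma start_time_le: "start_time \<alpha> n \<le> n"
  by (simp add: start_time_def)

text \<open>
  The bounds below hold for all \<open>n\<close> in the following range. The first condition makes the losses from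
  rounding negligible; the second makes the final block short and, since the height of the window is
  at most half of \<open>sqrt (n powr \<alpha>)\<close>, the window narrow enough for \<open>window_prob_lower\<close>.
\<close>

context
  fixes \<alpha> :: real and n :: nat
  assumes long: "64 \<le> real n powr \<alpha>" and short: "16 * real n powr \<alpha> \<le> real n"
begin

lemma length_pos: "0 < n"
  using long short by linarith

lemma half_length_bounds:
  "real (half_length \<alpha> n) \<le> real n powr \<alpha>" "real n powr \<alpha> < real (half_length \<alpha> n) + 1"
  unfolding half_length_def using long by (simp_all add: of_nat_floor)

lemma remaining_steps:
  "n - start_time \<alpha> n = 2 * half_length \<alpha> n + 1"
  "real (n - start_time \<alpha> n) \<le> 3 * real n powr \<alpha>"
  "real n / 2 \<le> real (start_time \<alpha> n)"
proof -
  have "2 * real (half_length \<alpha> n) + 1 \<le> 3 * real n powr \<alpha>"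
    using half_length_bounds long by linarith
  moreover from this have "real (2 * half_length \<alpha> n + 1) \<le> real n"
    using short long by simp
  then have le: "2 * half_length \<alpha> n + 1 \<le> n"
    by (simp only: of_nat_le_iff)
  ultimately show "n - start_time \<alpha> n = 2 * half_length \<alpha> n + 1"
    "real (n - start_time \<alpha> n) \<le> 3 * real n powr \<alpha>"
    "real n / 2 \<le> real (start_time \<alpha> n)"
    using short long unfolding start_time_def by (simp_all add: of_nat_diff)
qed

lemma sqrt_powr_ratio: "sqrt (real n powr \<alpha>) / sqrt (real n) = real n powr ((\<alpha> - 1) / 2)"
proof -
  have "real n powr ((\<alpha> - 1) / 2) = real n powr (\<alpha> / 2) / real n powr (1 / 2)"
    by (simp add: diff_divide_distrib powr_diff)
  then show ?thesis
    using length_pos by (simp add: powr_half_sqrt[symmetric] powr_powr)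
qed

lemma powr_ratio: "real n powr \<alpha> / real n = (real n powr ((\<alpha> - 1) / 2)) powr 2"
proof -
  have "(real n powr ((\<alpha> - 1) / 2)) powr 2 = real n powr (\<alpha> - 1)"
    unfolding powr_powr by (rule arg_cong) simp
  then show ?thesis
    using length_pos by (simp add: powr_diff)
qed

lemma window_height_bounds:
  "sqrt (real n powr \<alpha>) / 8 \<le> real (window_height \<alpha> n)"
  "real (window_height \<alpha> n) \<le> sqrt (real n powr \<alpha>) / 2"
proof -
  let ?t = "real n powr \<alpha>" and ?y = "sqrt (2 * real (half_length \<alpha> n) + 2)"
  have "8 \<le> sqrt ?t"
    using long real_le_rsqrt[of 8 ?t] by simp
  moreover have "sqrt ?t \<le> ?y"
    using half_length_bounds long by simp
  moreover have "?y / 4 < real (window_height \<alpha> n) + 1"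
    unfolding window_height_def by simp
  ultimately show "sqrt ?t / 8 \<le> real (window_height \<alpha> n)"
    by linarith
  have "?y \<le> sqrt (4 * ?t)"
    using half_length_bounds long by (intro real_sqrt_le_mono) linarith
  then have "?y \<le> 2 * sqrt ?t"
    by (simp add: real_sqrt_mult)
  then show "real (window_height \<alpha> n) \<le> sqrt ?t / 2"
    using window_height_le[of \<alpha> n] by linarith
qed

lemma window_mass_le: "window_mass \<alpha> n \<le> real n powr ((\<alpha> - 1) / 2)"
proof -
  \<comment> \<open>The factor 2 lost here is the one gained in the height of the window.\<close>
  have "sqrt (real n) / 2 \<le> sqrt (real (start_time \<alpha> n) + 1)"
  proof -
    have "sqrt (real n / 4) \<le> sqrt (real (start_time \<alpha> n) + 1)"
      using remaining_steps(3) by (intro real_sqrt_le_mono) linarith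
    then show ?thesis by (simp add: real_sqrt_divide)
  qed
  then have "window_mass \<alpha> n \<le> (sqrt (real n powr \<alpha>) / 2) / (sqrt (real n) / 2)"
    using length_pos window_height_bounds(2)
    by (intro order.trans[OF window_prob_upper] frac_le) auto
  then show ?thesis
    by (simp add: sqrt_powr_ratio)
qed

lemma mds_s_bounds: "sqrt (real n) / 2 \<le> mds_s (fair_signs n) n (window_stopped \<alpha> n)" "mds_s (fair_signs n) n (window_stopped \<alpha> n) \<le> sqrt (real n)"
proof -
  \<comment> \<open>The final block has length at most \<open>n / 2\<close>, hence switching it off costs at most half of the variance.\<close>
  let ?k = "real (n - start_time \<alpha> n)"
  have "0 \<le> ?k * window_mass \<alpha> n" "?k * window_mass \<alpha> n \<le> ?k"
    by (auto simp: walk_prob_nonneg walk_prob_le_1 mult_left_le)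
  moreover have "?k \<le> real n / 2"
    using remaining_steps(2) short long by linarith
  ultimately have "real n / 4 \<le> mds_s2 (fair_signs n) n (window_stopped \<alpha> n)" "mds_s2 (fair_signs n) n (window_stopped \<alpha> n) \<le> real n"
    unfolding mds_s2_stopped_signs[OF start_time_le[of \<alpha> n]] by linarith+
  then have "sqrt (real n / 4) \<le> mds_s (fair_signs n) n (window_stopped \<alpha> n)" "mds_s (fair_signs n) n (window_stopped \<alpha> n) \<le> sqrt (real n)"
    unfolding mds_s_def by (simp_all only: real_sqrt_le_iff)
  then show "sqrt (real n) / 2 \<le> mds_s (fair_signs n) n (window_stopped \<alpha> n)" "mds_s (fair_signs n) n (window_stopped \<alpha> n) \<le> sqrt (real n)"
    by (simp_all add: real_sqrt_divide)
qed

text \<open>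
  Up to constants, \<open>V\<^sup>2 - 1\<close> is of size \<open>\<delta>\<^sup>2\<close> with probability \<open>\<delta>\<close>, where
  \<open>\<delta> = n powr ((\<alpha> - 1) / 2)\<close>. Its \<open>p\<close>-th moment is of order \<open>\<delta> powr (2 * p + 1)\<close>, and the exponent
  \<open>p / (2 * p + 1)\<close> of the norm brings this back to \<open>\<delta>\<close>.
\<close>

lemma norm_V2_le:
  assumes "1 \<le> p"
  defines "N \<equiv> Lp_norm (fair_signs n) (ennreal p) (\<lambda>\<omega>. mds_V2 (fair_signs n) n (window_stopped \<alpha> n) \<omega> - 1)"
  shows "N < \<infinity>"
    and "enn2real N powr (p / (2 * p + 1))
      \<le> (2 * 6 powr p) powr (1 / (2 * p + 1)) * real n powr ((\<alpha> - 1) / 2)"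
proof -
  let ?\<delta> = "real n powr ((\<alpha> - 1) / 2)" and ?k = "real (n - start_time \<alpha> n)"
  let ?B = "2 * window_mass \<alpha> n * (2 * ?k / real n) powr p"
  have k: "2 * ?k \<le> 6 * real n powr \<alpha>"
    using remaining_steps(2) by linarith
  then have "real (2 * (n - start_time \<alpha> n)) \<le> real n"
    using short long unfolding of_nat_mult by simp
  then have "2 * (n - start_time \<alpha> n) \<le> n"
    unfolding of_nat_le_iff .
  then have N: "N \<le> ennreal (?B powr (1 / p))"
    unfolding N_def using assms(1) length_pos start_time_le
    by (intro Lp_norm_V2_le) simp_all
  then show "N < \<infinity>"
    by (simp add: order.strict_trans1)
  have "2 * ?k / real n \<le> 6 * ?\<delta> powr 2"
    using divide_right_mono[OF k, of "real n"] by (simp add: powr_ratio[symmetric])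
  then have "(2 * ?k / real n) powr p \<le> (6 * ?\<delta> powr 2) powr p"
    using assms(1) by (intro powr_mono2) auto
  then have "?B \<le> 2 * ?\<delta> * (6 * ?\<delta> powr 2) powr p"
    using window_mass_le by (intro mult_mono) (auto simp: walk_prob_nonneg)
  also have "\<dots> = 2 * 6 powr p * ?\<delta> powr (2 * p + 1)"
  proof -
    have "2 * d * (6 * d powr 2) powr p = 2 * 6 powr p * d powr (2 * p + 1)" if "0 < d" for d :: real
      using that by (simp add: powr_mult powr_powr powr_add del: powr_numeral)
    then show ?thesis
      using length_pos by simp
  qed
  finally have B: "?B \<le> 2 * 6 powr p * ?\<delta> powr (2 * p + 1)" .
  have "enn2real N powr (p / (2 * p + 1)) \<le> (?B powr (1 / p)) powr (p / (2 * p + 1))"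
    using assms(1) N by (intro powr_mono2 enn2real_leI) auto
  also have "\<dots> = ?B powr (1 / (2 * p + 1))"
    using assms(1) by (simp add: powr_powr)
  also have "\<dots> \<le> (2 * 6 powr p * ?\<delta> powr (2 * p + 1)) powr (1 / (2 * p + 1))"
    using assms(1) B by (intro powr_mono2) (auto simp: walk_prob_nonneg)
  also have "\<dots> = (2 * 6 powr p) powr (1 / (2 * p + 1)) * (?\<delta> powr (2 * p + 1)) powr (1 / (2 * p + 1))"
    by (rule powr_mult)
  also have "(?\<delta> powr (2 * p + 1)) powr (1 / (2 * p + 1)) = ?\<delta>"
    unfolding powr_powr[of ?\<delta>] using assms(1) length_pos by simp
  finally show "enn2real N powr (p / (2 * p + 1))
      \<le> (2 * 6 powr p) powr (1 / (2 * p + 1)) * ?\<delta>" .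
qed

lemma mds_D_lower_odd:
  assumes "odd n"
  shows "real n powr ((\<alpha> - 1) / 2) / 128 \<le> mds_D (fair_signs n) n (window_stopped \<alpha> n)"
proof -
  let ?h = "window_height \<alpha> n"
  \<comment> \<open>The final block has odd length.\<close>
  have "even (start_time \<alpha> n)"
    using assms start_time_le[of \<alpha> n] even_diff_nat[of n "start_time \<alpha> n"]
    unfolding remaining_steps(1) by simp
  then obtain q where q: "start_time \<alpha> n = 2 * q" by (elim evenE)
  have n: "n = 2 * q + (2 * half_length \<alpha> n + 1)"
    using remaining_steps(1) start_time_le[of \<alpha> n] q by linarith
  have q4: "real n / 4 \<le> real q" "real q \<le> real n"
    using remaining_steps(3) start_time_le[of \<alpha> n] q by simp_all
  have "(real ?h)\<^sup>2 \<le> (sqrt (real n powr \<alpha>) / 2)\<^sup>2"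
    using window_height_bounds(2) by (intro power_mono) auto
  then have "2 * (real ?h)\<^sup>2 \<le> real q + 1"
    using q4 short by (simp add: power_divide)
  moreover have "1 \<le> q"
    using q4 length_pos by linarith
  ultimately have mass: "real ?h / (4 * sqrt (real q)) \<le> window_mass \<alpha> n"
    unfolding q by (intro window_prob_lower)
  have "real n powr ((\<alpha> - 1) / 2) / 32 = (sqrt (real n powr \<alpha>) / 8) / (4 * sqrt (real n))"
    by (simp flip: sqrt_powr_ratio)
  also have "\<dots> \<le> real ?h / (4 * sqrt (real q))"
    using window_height_bounds(1) q4 \<open>1 \<le> q\<close> by (intro frac_le) auto
  finally have "real n powr ((\<alpha> - 1) / 2) / 128 \<le> window_mass \<alpha> n / 4"
    using mass by linarith
  also have "\<dots> \<le> mds_D (fair_signs n) n (window_stopped \<alpha> n)"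
  proof -
    have "0 < mds_s (fair_signs n) n (window_stopped \<alpha> n)"
      using mds_s_bounds(1) length_pos by (intro less_le_trans[OF _ mds_s_bounds(1)]) simp
    then show ?thesis
      using mds_D_stopped_signs_lower[OF window_height_le n] unfolding q by blast
  qed
  finally show ?thesis .
qed

end

theorem theorem1p6:
  fixes p \<alpha> :: real
  assumes "1 \<le> p" and "1 / 2 < \<alpha>" and "\<alpha> < 1"
  shows "\<exists>(M :: nat \<Rightarrow> (nat \<Rightarrow> real) measure) (X :: nat \<Rightarrow> nat \<Rightarrow> (nat \<Rightarrow> real) \<Rightarrow> real).
    (\<forall>n\<ge>1. mart_diff_seq (M n) n (X n)) \<and>
    (\<forall>n\<ge>1. seq_norm (M n) \<infinity> n (X n) \<le> 2) \<and>
    same_order (\<lambda>n. mds_s (M n) n (X n)) (\<lambda>n. sqrt (real n)) \<and>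
    ((\<forall>\<^sub>F n in sequentially. Lp_norm (M n) (ennreal p) (\<lambda>\<omega>. mds_V2 (M n) n (X n) \<omega> - 1) < \<infinity>) \<and>
     (\<lambda>n. enn2real (Lp_norm (M n) (ennreal p) (\<lambda>\<omega>. mds_V2 (M n) n (X n) \<omega> - 1))
             powr (p / (2 * p + 1))) \<in> O(\<lambda>n. real n powr ((\<alpha> - 1) / 2))) \<and>
    limsup (\<lambda>n. ereal (real n powr ((1 - \<alpha>) / 2) * mds_D (M n) n (X n))) > 0"
proof -
  let ?M = "\<lambda>n. measure_pmf (fair_signs n)"
  let ?X = "window_stopped \<alpha>"
  have "\<forall>\<^sub>F n in sequentially. 64 \<le> real n powr \<alpha>"
    using assms by real_asymp
  moreover have "\<forall>\<^sub>F n in sequentially. 16 * real n powr \<alpha> \<le> real n"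
    using assms by real_asymp
  ultimately have ev: "\<forall>\<^sub>F n in sequentially. 64 \<le> real n powr \<alpha> \<and> 16 * real n powr \<alpha> \<le> real n"
    by eventually_elim simp
  have s: "same_order (\<lambda>n. mds_s (?M n) n (?X n)) (\<lambda>n. sqrt (real n))"
    unfolding same_order_def
  proof (intro exI[of _ 2] conjI)
    show "\<forall>\<^sub>F n in sequentially. mds_s (?M n) n (?X n) / 2 \<le> sqrt (real n) \<and>
        sqrt (real n) \<le> 2 * mds_s (?M n) n (?X n)"
      using ev
    proof eventually_elim
      case (elim n)
      then have "sqrt (real n) / 2 \<le> mds_s (?M n) n (?X n)" "mds_s (?M n) n (?X n) \<le> sqrt (real n)"
        using mds_s_bounds by blast+
      then show ?case
        using real_sqrt_ge_zero[of "real n"] by simp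
    qed
  qed simp
  have V: "\<forall>\<^sub>F n in sequentially.
      Lp_norm (?M n) (ennreal p) (\<lambda>\<omega>. mds_V2 (?M n) n (?X n) \<omega> - 1) < \<infinity>"
    using ev by eventually_elim (use norm_V2_le(1) assms(1) in blast)
  have O: "(\<lambda>n. enn2real (Lp_norm (?M n) (ennreal p) (\<lambda>\<omega>. mds_V2 (?M n) n (?X n) \<omega> - 1))
      powr (p / (2 * p + 1))) \<in> O(\<lambda>n. real n powr ((\<alpha> - 1) / 2))"
  proof (rule bigoI[where c = "(2 * 6 powr p) powr (1 / (2 * p + 1))"])
    show "\<forall>\<^sub>F n in sequentially.
      norm (enn2real (Lp_norm (?M n) (ennreal p) (\<lambda>\<omega>. mds_V2 (?M n) n (?X n) \<omega> - 1)) powr (p / (2 * p + 1)))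
      \<le> (2 * 6 powr p) powr (1 / (2 * p + 1)) * norm (real n powr ((\<alpha> - 1) / 2))"
      using ev
    proof eventually_elim
      case (elim n)
      then show ?case
        using norm_V2_le(2)[of n \<alpha> p] assms(1) by simp
    qed
  qed
  have D: "0 < limsup (\<lambda>n. ereal (real n powr ((1 - \<alpha>) / 2) * mds_D (?M n) n (?X n)))"
  proof (rule ccontr)
    assume "\<not> ?thesis"
    then have "limsup (\<lambda>n. ereal (real n powr ((1 - \<alpha>) / 2) * mds_D (?M n) n (?X n))) < ereal (1 / 128)"
      by (simp add: not_less le_less_trans)
    then have "\<forall>\<^sub>F n in sequentially. real n powr ((1 - \<alpha>) / 2) * mds_D (?M n) n (?X n) < 1 / 128"
      by (auto dest: Limsup_lessD)
    \<comment> \<open>Otherwise the lower bound for odd lengths would fail for all large \<open>n\<close>.\<close>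
    with ev have "\<forall>\<^sub>F n in sequentially. even n"
    proof eventually_elim
      case (elim n)
      show "even n"
      proof (rule ccontr)
        assume "odd n"
        then have "real n powr ((\<alpha> - 1) / 2) / 128 \<le> mds_D (?M n) n (?X n)"
          using mds_D_lower_odd elim by blast
        then have "real n powr ((1 - \<alpha>) / 2) * (real n powr ((\<alpha> - 1) / 2) / 128)
            \<le> real n powr ((1 - \<alpha>) / 2) * mds_D (?M n) n (?X n)"
          by (intro mult_left_mono) auto
        moreover have "real n powr ((1 - \<alpha>) / 2) * real n powr ((\<alpha> - 1) / 2) = 1"
          using \<open>odd n\<close> by (simp add: powr_add[symmetric] add_divide_distrib[symmetric] odd_pos)
        ultimately show False
          using elim by simp
      qed
    qed
    then obtain N :: nat where "\<forall>n\<ge>N. even n"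
      unfolding eventually_sequentially by blast
    then have "even (2 * N + 1)"
      by (rule allE[of _ "2 * N + 1"]) simp
    then show False
      by simp
  qed
  show ?thesis
    using mart_diff_seq_stopped_signs seq_norm_stopped_signs_le s V O D
    by (intro exI[of _ ?M] exI[of _ ?X]) blast
qed

end
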